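(* Let $\Sigma$ be a planar model with $T$-invariant ergodic selection measure $\mathbb P$, and $\alpha=\dim(\Sigma)$. Then for every $q\in\mathbb N$ and every $\delta>0$, $$\lim_{n\to\infty}\mathbb P\Big(\Big\{\omega\in\Omega:\ \big|H_{qn}(\eta^{(T^{n'(\omega)}\omega)})-\alpha\big|<\delta\Big\}\Big)=1.$$
   Context: Planar model $\Sigma=((\Phi^{(i)})_{i\in I},(p_i)_{i\in I},\mathbb P)$: $I$ finite; $\Phi^{(i)}=(f^{(i)}_j)_{j\le k_i}$, $f^{(i)}_j(z)=\lambda_iz+t^{(i)}_j$, $\lambda_i=r_i\varphi_i$, $0<r_i<1$, $|\varphi_i|=1$; $p_i$ positive probability vectors; $\mathbb P$ on $\Omega=I^{\mathbb N}$, $T$ the shift. $\eta^{(\omega)}$ is the law of $\sum_{n\ge1}(\prod_{j<n}\lambda_{\omega_j})t^{(\omega_n)}_{u_n}$, $u_n$ independent with laws $p_{\omega_n}$. For ergodic $\mathbb P$, there is $\alpha\in[0,2]$ with $\eta^{(\omega)}$ exact dimensional of dimension $\alpha=\dim(\Sigma)$ for $\mathbb P$-a.e. $\omega$. Fix $R>0$ with $\overline{f^{(i)}_j(B(0,R))}\subset B(0,R)$ and $2R\min_ir_i>1/2$; $n'(\omega)$ is the natural number with $2R\prod_{i=1}^{n'}r_{\omega_i}\le2^{-n}\le2R\prod_{i=1}^{n'-1}r_{\omega_i}$. $H_n(\mu)=\frac1nH(\mu,\mathcal D_n)$, $\mathcal D_n$ dyadic squares of side $2^{-n}$, log base 2.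 *)

theory Defs
  imports "HOL-Probability.Probability"
begin

text \<open>Symbolic space \<Omega> = I^\<nat>, indexed from 0 (so \<omega>_1 of the paper is \<omega> 0).\<close>

definition shift :: "(nat \<Rightarrow> 'i) \<Rightarrow> (nat \<Rightarrow> 'i)" where
  "shift \<omega> = (\<lambda>n. \<omega> (Suc n))"

definition Omega_space :: "(nat \<Rightarrow> 'i) measure" where
  "Omega_space = PiM UNIV (\<lambda>_. count_space UNIV)"

definition ergodic_selection :: "(nat \<Rightarrow> 'i) measure \<Rightarrow> bool" where
  "ergodic_selection P \<longleftrightarrow>
     prob_space P \<and> sets P = sets Omega_space \<and>
     shift \<in> measurable P P \<and> distr P P shift = P \<and>
     (\<forall>A \<in> sets P. shift -` A \<inter> space P = A \<longrightarrow>
         measure P A = 0 \<or> measure P A = 1)"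

definition digit_pmf :: "('i \<Rightarrow> nat) \<Rightarrow> ('i \<Rightarrow> nat \<Rightarrow> real) \<Rightarrow> 'i \<Rightarrow> nat pmf" where
  "digit_pmf k p i = embed_pmf (\<lambda>j. if j < k i then p i j else 0)"

definition eta :: "('i \<Rightarrow> complex) \<Rightarrow> ('i \<Rightarrow> nat) \<Rightarrow> ('i \<Rightarrow> nat \<Rightarrow> complex)
      \<Rightarrow> ('i \<Rightarrow> nat \<Rightarrow> real) \<Rightarrow> (nat \<Rightarrow> 'i) \<Rightarrow> complex measure" where
  "eta lam k t p \<omega> =
     distr (PiM UNIV (\<lambda>n. measure_pmf (digit_pmf k p (\<omega> n)))) borel
       (\<lambda>u. \<Sum>n. (\<Prod>j<n. lam (\<omega> j)) * t (\<omega> n) (u n))"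

definition exact_dim :: "complex measure \<Rightarrow> real \<Rightarrow> bool" where
  "exact_dim \<mu> \<alpha> \<longleftrightarrow>
     (AE x in \<mu>. ((\<lambda>r. ln (measure \<mu> (ball x r)) / ln r) \<longlongrightarrow> \<alpha>) (at_right 0))"

definition dyadic_square :: "nat \<Rightarrow> int \<Rightarrow> int \<Rightarrow> complex set" where
  "dyadic_square n a b =
     {z. real_of_int a / 2^n \<le> Re z \<and> Re z < (real_of_int a + 1) / 2^n \<and>
         real_of_int b / 2^n \<le> Im z \<and> Im z < (real_of_int b + 1) / 2^n}"

definition dyadic_entropy :: "complex measure \<Rightarrow> nat \<Rightarrow> real" where
  "dyadic_entropy \<mu> n =
     infsum (\<lambda>(a, b). - measure \<mu> (dyadic_square n a b) * log 2 (measure \<mu> (dyadic_square n a b)))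
       (UNIV :: (int \<times> int) set)"

definition H_norm :: "nat \<Rightarrow> complex measure \<Rightarrow> real" where
  "H_norm n \<mu> = dyadic_entropy \<mu> n / real n"

definition nprime :: "('i \<Rightarrow> complex) \<Rightarrow> real \<Rightarrow> nat \<Rightarrow> (nat \<Rightarrow> 'i) \<Rightarrow> nat" where
  "nprime lam R n \<omega> = (LEAST m. 2 * R * (\<Prod>i<m. cmod (lam (\<omega> i))) \<le> (1/2) ^ n)"

end

theory Submission
  imports Defs "HOL-Real_Asymp.Real_Asymp"
begin

text \<open>Exact dimensionality of a boundedly supported measure forces its normalised dyadic entropies to
  converge to the dimension, so \<open>H_norm (q * n) (\<eta> \<omega>)\<close> converges to \<open>\<alpha>\<close> almost surely, hence in
  probability. It remains to replace \<open>\<omega>\<close> by its image under the shift iterated \<open>nprime\<close> times. By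
  invariance of \<open>P\<close>, the law of this image has a density with respect to \<open>P\<close> that is bounded by the
  number of past times from which the stopping rule stops exactly now, and since all the ratios lie
  in a compact subinterval of \<open>(0, 1)\<close> this number is bounded independently of \<open>n\<close>.\<close>

subsection \<open>Randomly stopped iterates of a measure-preserving map\<close>

lemma (in finite_measure) measure_random_iterate_le:
  assumes T: "T \<in> measurable M M" "distr M M T = M"
    and tau: "tau \<in> measurable M (count_space UNIV)"
    and bound: "\<And>x. x \<in> space M \<Longrightarrow> tau x \<le> m"
    and A: "A \<in> sets M"
    and count: "\<And>x. x \<in> space M \<Longrightarrow> card {j. j \<le> m \<and> tau ((T ^^ j) x) = m - j} \<le> K"
  shows "measure M {x \<in> space M. (T ^^ tau x) x \<in> A} \<le> real K * measure M A"
  \<comment> \<open>Invariance moves each event \<open>tau x = j \<and> (T ^^ j) x \<in> A\<close> so that it ends at the common time \<open>m\<close>.\<close>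
proof -
  have Tj[measurable]: "T ^^ j \<in> measurable M M" for j
    using T(1) by (induction j) auto
  have dj: "distr M M (T ^^ j) = M" for j
  proof (induction j)
    case (Suc j)
    have "distr M M (T ^^ Suc j) = distr (distr M M (T ^^ j)) M T"
      using T(1) by (simp add: distr_distr comp_def)
    then show ?case using Suc T(2) by (simp add: comp_def)
  qed (auto simp: distr_id2 id_def)
  have inv: "measure M ((T ^^ j) -` B \<inter> space M) = measure M B" if "B \<in> sets M" for j B
    using measure_distr[OF Tj that, of j] dj by simp
  note [measurable] = tau A
  define E where "E j = {x \<in> space M. tau x = j \<and> (T ^^ j) x \<in> A}" for j
  have E[measurable]: "E j \<in> sets M" for j unfolding E_def by measurable
  \<comment> \<open>\<open>F j\<close> is \<open>E (m - j)\<close> pulled back by \<open>j\<close>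
    steps: counted from time \<open>j\<close> the stopping time is \<open>m - j\<close>, so the
    visit to \<open>A\<close> takes place at time \<open>m\<close> whatever \<open>j\<close>
    is.\<close>
  define F where "F j = (T ^^ j) -` E (m - j) \<inter> space M" for j
  have F[measurable]: "F j \<in> sets M" for j unfolding F_def by measurable
  define C where "C = (T ^^ m) -` A \<inter> space M"
  have C[measurable]: "C \<in> sets M" unfolding C_def by measurable
  have "{x \<in> space M. (T ^^ tau x) x \<in> A} = (\<Union>j\<in>{..m}. E j)"
    unfolding E_def using bound by auto
  also have "measure M \<dots> = (\<Sum>j\<le>m. measure M (E j))"
    by (intro finite_measure_finite_Union) (auto simp: disjoint_family_on_def E_def)
  also have "\<dots> = (\<Sum>j\<le>m. measure M (E (m - j)))"
    by (rule sum.reindex_bij_witness[of _ "\<lambda>j. m - j" "\<lambda>j. m - j"]) auto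
  also have "\<dots> = (\<Sum>j\<le>m. measure M (F j))"
    unfolding F_def by (simp add: inv)
  also have "\<dots> = (\<Sum>j\<le>m. \<integral>x. indicator (F j) x \<partial>M)"
    by (intro sum.cong refl) (simp add: F_def Int_absorb2 sets.sets_into_space)
  also have "\<dots> = (\<integral>x. (\<Sum>j\<le>m. indicator (F j) x) \<partial>M)"
    by (intro Bochner_Integration.integral_sum[symmetric] integrable_real_indicator F) (simp add: emeasure_eq_measure)
  also have "\<dots> \<le> (\<integral>x. real K * indicator C x \<partial>M)"
  proof (intro integral_mono)
    fix x assume x: "x \<in> space M"
    \<comment> \<open>The point tested against \<open>A\<close> is \<open>(T ^^ m) x\<close> for
      every \<open>j\<close>, so the sum of indicators is that of \<open>C\<close> times the number
      of admissible \<open>j\<close>, which \<open>count\<close> bounds.\<close>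
    have *: "indicator (F j) x = (if tau ((T ^^ j) x) = m - j then indicator C x else (0::real))"
      if "j \<le> m" for j
    proof -
      have "(T ^^ (m - j)) ((T ^^ j) x) = (T ^^ m) x"
        using that by (metis comp_apply funpow_add le_add_diff_inverse2)
      moreover have "(T ^^ j) x \<in> space M" using measurable_space[OF Tj x] .
      ultimately show ?thesis using x by (auto simp: F_def E_def C_def indicator_def)
    qed
    have "(\<Sum>j\<le>m. indicator (F j) x) = 
        (\<Sum>j\<le>m. if tau ((T ^^ j) x) = m - j then indicator C x else (0::real))"
      using * by (intro sum.cong) auto
    also have "\<dots> = real (card {j. j \<le> m \<and> tau ((T ^^ j) x) = m - j}) * indicator C x"
      by (subst sum.inter_filter[symmetric]) auto
    also have "\<dots> \<le> real K * indicator C x"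
      using count[OF x] by (intro mult_right_mono) auto
    finally show "(\<Sum>j\<le>m. indicator (F j) x) \<le> real K * indicator C x" .
  qed (auto intro!: integrable_sum integrable_real_indicator F C simp: emeasure_eq_measure)
  also have "\<dots> = real K * measure M C"
    by (simp add: C_def Int_absorb2 sets.sets_into_space)
  finally show ?thesis unfolding C_def by (simp add: inv)
qed

lemma shift_funpow: "(shift ^^ j) w = (\<lambda>n. w (n + j))"
  by (induction j) (auto simp: shift_def)

section \<open>Stopping rule given by products of contraction ratios\<close>

locale contraction_ratios =
  fixes lam :: "'i::finite \<Rightarrow> complex"
  assumes lam: "\<And>i. 0 < cmod (lam i) \<and> cmod (lam i) < 1"
begin

definition "rmax = (MAX i. cmod (lam i))"
definition "rmin = (MIN i. cmod (lam i))"

lemma rmax: "0 < rmax" "rmax < 1" "cmod (lam i) \<le> rmax"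
proof -
  have "rmax \<in> range (\<lambda>i. cmod (lam i))" unfolding rmax_def by (intro Max_in) auto
  then show "0 < rmax" "rmax < 1" using lam by auto
  show "cmod (lam i) \<le> rmax" unfolding rmax_def by (intro Max_ge) auto
qed

lemma rmin: "0 < rmin" "rmin \<le> cmod (lam i)"
proof -
  have "rmin \<in> range (\<lambda>i. cmod (lam i))" unfolding rmin_def by (intro Min_in) auto
  then show "0 < rmin" using lam by auto
  show "rmin \<le> cmod (lam i)" unfolding rmin_def by (intro Min_le) auto
qed

lemma prod_lam_le: "(\<Prod>i\<in>A. cmod (lam (f i))) \<le> rmax ^ card A" for f :: "nat \<Rightarrow> 'i"
  using prod_mono[of A "\<lambda>i. cmod (lam (f i))" "\<lambda>_. rmax"] rmax(3) by simp

text \<open>The products decay at least like \<open>rmax ^ m\<close> for all words at once. A single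
  \<open>m\<close> therefore shows that the \<open>LEAST\<close> in \<open>nprime\<close> is
  attained and bounds it uniformly.\<close>

lemma nprime_witness:
  obtains m :: nat where "\<And>w. 2 * R * (\<Prod>i<m. cmod (lam (w i))) \<le> (1/2) ^ n"
proof -
  have "(\<lambda>m. 2 * \<bar>R\<bar> * rmax ^ m) \<longlonglongrightarrow> 2 * \<bar>R\<bar> * 0"
    using rmax by (intro tendsto_intros LIMSEQ_power_zero) auto
  then have "eventually (\<lambda>m. 2 * \<bar>R\<bar> * rmax ^ m < (1/2) ^ n) sequentially"
    by (rule order_tendstoD) auto
  then obtain m where m: "2 * \<bar>R\<bar> * rmax ^ m < (1/2) ^ n"
    by (auto simp: eventually_sequentially)
  have "2 * R * (\<Prod>i<m. cmod (lam (w i))) \<le> (1/2) ^ n" for w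
  proof -
    have "2 * R * (\<Prod>i<m. cmod (lam (w i))) \<le> 2 * \<bar>R\<bar> * (\<Prod>i<m. cmod (lam (w i)))"
      by (intro mult_right_mono prod_nonneg) auto
    also have "\<dots> \<le> 2 * \<bar>R\<bar> * rmax ^ m"
      using prod_lam_le[of w "{..<m}"] by (intro mult_left_mono) auto
    finally show ?thesis using m by simp
  qed
  then show thesis by (rule that)
qed

lemma nprime_bounded: obtains m where "\<And>w. nprime lam R n w \<le> m"
  using nprime_witness[of R n] unfolding nprime_def by (metis Least_le)

lemma nprime_upper: "2 * R * (\<Prod>i<nprime lam R n w. cmod (lam (w i))) \<le> (1/2) ^ n"
  using nprime_witness[of R n] unfolding nprime_def by (metis (mono_tags, lifting) LeastI)

text \<open>Minimality of the stopping time, read one factor earlier; writing it as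
  \<open>Suc l\<close> ensures that an earlier index exists.\<close>

lemma nprime_lower:
  assumes "Suc l = nprime lam R n w"
  shows "(1/2) ^ n < 2 * R * (\<Prod>i<l. cmod (lam (w i)))"
proof (rule ccontr)
  assume "\<not> ?thesis"
  then have "nprime lam R n w \<le> l" unfolding nprime_def by (intro Least_le) auto
  then show False using assms by simp
qed

text \<open>Seen from time \<open>m\<close>, the starting times \<open>j < m\<close> whose stopping time ends exactly at \<open>m\<close> have
  \<open>2 R r\<^sub>j \<cdots> r\<^sub>m\<^sub>-\<^sub>1\<close> in \<open>(2\<^sup>-\<^sup>n rmin, 2\<^sup>-\<^sup>n]\<close>, so they lie in a window of fixed length.\<close>

lemma card_nprime_le:
  assumes R: "R > 0" and K: "rmax ^ K \<le> rmin"
  shows "card {j. j \<le> m \<and> nprime lam R n ((shift ^^ j) w) = m - j} \<le> Suc K"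
proof -
  define s where "s j = 2 * R * (\<Prod>i\<in>{j..<m}. cmod (lam (w i)))" for j
  \<comment> \<open>The start \<open>j = m\<close> is left out, since a stopping time 0 has no last
    factor to remove. Adding it back turns \<open>K\<close> into \<open>Suc K\<close>.\<close>
  define J where "J = {j. j < m \<and> nprime lam R n ((shift ^^ j) w) = m - j}"
  have finJ: "finite J" unfolding J_def by auto
  have shift_prod: "(\<Prod>i<l. cmod (lam ((shift ^^ j) w i))) = (\<Prod>i\<in>{j..<j+l}. cmod (lam (w i)))" for j l
    by (rule prod.reindex_bij_witness[of _ "\<lambda>i. i - j" "\<lambda>i. i + j"]) (auto simp: shift_funpow)
  have up: "s j \<le> (1/2) ^ n" if "j \<in> J" for j
    using nprime_upper[where w="(shift ^^ j) w" and R=R and n=n] that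
    unfolding shift_prod by (simp add: J_def s_def)
  \<comment> \<open>Without its last factor the product still exceeds \<open>(1/2) ^ n\<close>, and
    that factor is at least \<open>rmin\<close>.\<close>
  have lo: "(1/2) ^ n * rmin < s j" if jJ: "j \<in> J" for j
  proof -
    obtain l where l: "m = j + Suc l" using jJ less_imp_Suc_add[of j m] unfolding J_def by auto
    have "(1/2) ^ n < 2 * R * (\<Prod>i\<in>{j..<j+l}. cmod (lam (w i)))"
      using nprime_lower[where l=l and R=R and n=n and w="(shift ^^ j) w"] that l unfolding shift_prod by (simp add: J_def)
    then have "(1/2) ^ n * rmin < 2 * R * (\<Prod>i\<in>{j..<j+l}. cmod (lam (w i))) * rmin"
      using rmin(1) by simp
    also have "\<dots> \<le> 2 * R * (\<Prod>i\<in>{j..<j+l}. cmod (lam (w i))) * cmod (lam (w (j + l)))"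
      using R by (intro mult_left_mono rmin mult_nonneg_nonneg prod_nonneg) auto
    also have "\<dots> = s j" unfolding s_def l by (simp add: mult.assoc)
    finally show ?thesis .
  qed
  \<comment> \<open>Two starts at distance \<open>K\<close> or more have products that differ by a
    factor of at most \<open>rmax ^ K\<close>, hence at most \<open>rmin\<close>; this would
    contradict \<open>lo\<close> at the earlier one.\<close>
  have close: "j2 < j1 + K" if "j1 \<in> J" "j2 \<in> J" for j1 j2
  proof (rule ccontr)
    assume far: "\<not> j2 < j1 + K"
    have lt: "j1 \<le> j2" "j2 < m" using far that by (auto simp: J_def)
    have "s j1 = (\<Prod>i\<in>{j1..<j2}. cmod (lam (w i))) * s j2"
      unfolding s_def using prod.atLeastLessThan_concat[of j1 j2 m "\<lambda>i. cmod (lam (w i))"] lt by simp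
    also have "\<dots> \<le> rmax ^ K * s j2"
    proof (intro mult_right_mono)
      have "(\<Prod>i\<in>{j1..<j2}. cmod (lam (w i))) \<le> rmax ^ (j2 - j1)"
        using prod_lam_le[of w "{j1..<j2}"] by simp
      also have "\<dots> \<le> rmax ^ K" using far rmax by (intro power_decreasing) auto
      finally show "(\<Prod>i\<in>{j1..<j2}. cmod (lam (w i))) \<le> rmax ^ K" .
      show "0 \<le> s j2" unfolding s_def using R by (intro mult_nonneg_nonneg prod_nonneg) auto
    qed
    also have "\<dots> \<le> rmin * (1/2) ^ n"
      using K up[OF that(2)] rmax rmin(1) R
      by (intro mult_mono) (auto simp: s_def intro!: prod_nonneg mult_nonneg_nonneg)
    finally show False using lo[OF that(1)] by (simp add: mult.commute)
  qed
  have "card J \<le> K"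
  proof (cases "J = {}")
    case False
    then have "Min J \<in> J" using finJ by (intro Min_in)
    then have "J \<subseteq> {Min J..<Min J + K}" using close finJ by auto
    then have "card J \<le> card {Min J..<Min J + K}" by (intro card_mono) auto
    then show ?thesis by simp
  qed simp
  moreover have "{j. j \<le> m \<and> nprime lam R n ((shift ^^ j) w) = m - j} \<subseteq> insert m J"
    by (auto simp: J_def)
  then have "card {j. j \<le> m \<and> nprime lam R n ((shift ^^ j) w) = m - j} \<le> card (insert m J)"
    using finJ by (intro card_mono) auto
  ultimately show ?thesis using finJ by (simp add: card_insert_if split: if_splits)
qed

end

subsection \<open>Dyadic entropy and exact dimension\<close>

text \<open>Dominated convergence of the indicators; used to pass from almost sure convergence to
  convergence in probability.\<close>

lemma (in prob_space) prob_tendsto_1: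
  assumes [measurable]: "\<And>n. A n \<in> events"
    and AE: "AE x in M. eventually (\<lambda>n. x \<in> A n) sequentially"
  shows "(\<lambda>n. prob (A n)) \<longlonglongrightarrow> 1"
proof -
  have "(\<lambda>n. \<integral>x. indicator (A n) x \<partial>M) \<longlonglongrightarrow> (\<integral>x. 1 \<partial>M :: real)"
  proof (rule integral_dominated_convergence[where w = "\<lambda>_. 1"])
    show "AE x in M. (\<lambda>n. indicator (A n) x :: real) \<longlonglongrightarrow> 1"
      using AE by eventually_elim (auto intro!: tendsto_eventually elim: eventually_mono)
  qed auto
  then show ?thesis by (simp add: Int_absorb2 sets.sets_into_space prob_space)
qed

text \<open>A point determines the indices of its square, so disjointness and covering reduce to
  facts about \<open>floor\<close>.\<close>

lemma mem_dyadic_square_iff: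
  "z \<in> dyadic_square n a b \<longleftrightarrow> a = \<lfloor>Re z * 2 ^ n\<rfloor> \<and> b = \<lfloor>Im z * 2 ^ n\<rfloor>"
proof -
  have "a = \<lfloor>x * 2 ^ n\<rfloor> \<longleftrightarrow> real_of_int a / 2 ^ n \<le> x \<and> x < (real_of_int a + 1) / 2 ^ n" for a x
    by (subst eq_commute, subst floor_eq_iff) (simp add: field_simps)
  then show ?thesis unfolding dyadic_square_def by auto
qed

lemma dyadic_square_borel [measurable]: "dyadic_square n a b \<in> sets borel"
  unfolding dyadic_square_def by measurable

text \<open>Follows termwise from \<open>ln x \<le> x - 1\<close> at \<open>x = v c / m c\<close>.
  The weights \<open>v\<close> may have smaller total mass than \<open>m\<close>, which leaves room
  for a crude comparison weight.\<close>

lemma gibbs_inequality: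
  fixes m v :: "'a \<Rightarrow> real"
  assumes "finite S" "\<And>c. c \<in> S \<Longrightarrow> 0 \<le> m c" "\<And>c. c \<in> S \<Longrightarrow> 0 < v c"
    and "sum v S \<le> sum m S"
  shows "(\<Sum>c\<in>S. - m c * log 2 (m c)) \<le> (\<Sum>c\<in>S. - m c * log 2 (v c))"
proof -
  have "m c * ln (v c) - m c * ln (m c) \<le> v c - m c" if "c \<in> S" for c
  proof (cases "m c = 0")
    case False
    then have pos: "m c > 0" "v c > 0" using assms(2,3) that by (auto simp: order_less_le)
    have "ln (v c / m c) \<le> v c / m c - 1" using pos by (intro ln_le_minus_one) auto
    then have "m c * ln (v c / m c) \<le> m c * (v c / m c - 1)"
      using pos by (intro mult_left_mono) auto
    then show ?thesis using pos by (simp add: ln_div algebra_simps)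
  qed (use assms(3)[OF that] in simp)
  then have "(\<Sum>c\<in>S. m c * ln (v c) - m c * ln (m c)) \<le> (\<Sum>c\<in>S. v c - m c)"
    by (intro sum_mono)
  also have "\<dots> \<le> 0" using assms(4) by (simp add: sum_subtractf)
  finally have "(\<Sum>c\<in>S. m c * ln (v c)) \<le> (\<Sum>c\<in>S. m c * ln (m c))"
    by (simp add: sum_subtractf)
  then have "(\<Sum>c\<in>S. m c * ln (v c)) / ln 2 \<le> (\<Sum>c\<in>S. m c * ln (m c)) / ln 2"
    by (intro divide_right_mono) auto
  then show ?thesis by (simp add: log_def sum_negf sum_divide_distrib)
qed

text \<open>With \<open>L\<close> an integer, the half-open box from \<open>-L\<close> to
  \<open>L\<close> in both coordinates is tiled exactly by these squares at every level.\<close>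

definition square_indices :: "int \<Rightarrow> nat \<Rightarrow> (int \<times> int) set" where
  "square_indices L n = {- (L * 2 ^ n)..<L * 2 ^ n} \<times> {- (L * 2 ^ n)..<L * 2 ^ n}"

lemma finite_square_indices [simp]: "finite (square_indices L n)"
  by (simp add: square_indices_def)

lemma card_square_indices: "L \<ge> 0 \<Longrightarrow> real (card (square_indices L n)) = (2 * L * 2 ^ n)\<^sup>2"
  by (simp add: square_indices_def card_cartesian_product power2_eq_square)

section \<open>Entropy bounds for a boundedly supported probability measure\<close>

locale bounded_plane_measure = prob_space \<mu> for \<mu> :: "complex measure" +
  fixes L :: int
  assumes sets_eq [measurable_cong]: "sets \<mu> = sets borel"
    and bounded: "AE z in \<mu>. cmod z < L"
begin

lemma space_eq [simp]: "space \<mu> = UNIV"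
  using sets_eq_imp_space_eq[OF sets_eq] by simp

abbreviation square :: "nat \<Rightarrow> int \<times> int \<Rightarrow> complex set" where
  "square n c \<equiv> dyadic_square n (fst c) (snd c)"

abbreviation mass :: "nat \<Rightarrow> int \<times> int \<Rightarrow> real" where
  "mass n c \<equiv> measure \<mu> (square n c)"

lemma square_events [measurable]: "square n c \<in> events"
  by (simp add: sets_eq)

lemma mem_square_indices:
  assumes "cmod z < L" "z \<in> square n c"
  shows "c \<in> square_indices L n"
proof -
  have *: "\<lfloor>x * 2 ^ n\<rfloor> \<in> {- (L * 2 ^ n)..<L * 2 ^ n}" if "\<bar>x\<bar> < L" for x :: real
  proof -
    have "\<bar>x * 2 ^ n\<bar> < real_of_int (L * 2 ^ n)" using that by (simp add: abs_mult)
    then have "real_of_int (- (L * 2 ^ n)) \<le> x * 2 ^ n" "x * 2 ^ n < real_of_int (L * 2 ^ n)"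
      unfolding of_int_minus by linarith+
    then show ?thesis by (simp only: atLeastLessThan_iff le_floor_iff floor_less_iff)
  qed
  have "\<bar>Re z\<bar> < L" "\<bar>Im z\<bar> < L"
    using assms(1) abs_Re_le_cmod[of z] abs_Im_le_cmod[of z] by linarith+
  then show ?thesis
    using assms(2) *[of "Re z"] *[of "Im z"]
    by (cases c) (auto simp: mem_dyadic_square_iff square_indices_def)
qed

lemma sum_measure_squares:
  assumes "finite F" "B \<in> events"
  shows "(\<Sum>c\<in>F. prob (square n c \<inter> B)) = prob ((\<Union>c\<in>F. square n c) \<inter> B)"
proof -
  have "prob (\<Union>c\<in>F. square n c \<inter> B) = (\<Sum>c\<in>F. prob (square n c \<inter> B))"
    using assms
    by (intro finite_measure_finite_Union)
       (auto simp: disjoint_family_on_def mem_dyadic_square_iff)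
  moreover have "(\<Union>c\<in>F. square n c \<inter> B) = (\<Union>c\<in>F. square n c) \<inter> B" by auto
  ultimately show ?thesis by simp
qed

lemma sum_mass_le_1: "finite F \<Longrightarrow> (\<Sum>c\<in>F. mass n c) \<le> 1"
  using sum_measure_squares[of F UNIV n] by simp

text \<open>Almost every point lies in the box tiled by these squares, so they carry the whole mass
  of any event.\<close>

lemma sum_measure_square_indices:
  assumes [measurable]: "B \<in> events"
  shows "(\<Sum>c\<in>square_indices L n. prob (square n c \<inter> B)) = prob B"
proof -
  have "prob ((\<Union>c\<in>square_indices L n. square n c) \<inter> B) = prob B"
  proof (rule finite_measure_eq_AE)
    show "AE z in \<mu>. (z \<in> (\<Union>c\<in>square_indices L n. square n c) \<inter> B) = (z \<in> B)"
      using bounded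
    proof eventually_elim
      case (elim z)
      define c where "c = (\<lfloor>Re z * 2 ^ n\<rfloor>, \<lfloor>Im z * 2 ^ n\<rfloor>)"
      have "z \<in> square n c" by (simp add: mem_dyadic_square_iff c_def)
      then show ?case using mem_square_indices[OF elim] by blast
    qed
  qed (auto intro!: sets.finite_UN sets.Int)
  then show ?thesis using sum_measure_squares[of "square_indices L n" B n] by simp
qed

lemma mass_outside: "c \<notin> square_indices L n \<Longrightarrow> mass n c = 0"
proof -
  assume c: "c \<notin> square_indices L n"
  have "AE z in \<mu>. z \<notin> square n c"
    using bounded by eventually_elim (use c mem_square_indices in blast)
  then show ?thesis by (subst (asm) AE_iff_measurable[OF _ refl]) (auto simp: measure_def)
qed

text \<open>Squares outside the box have mass 0 and contribute 0, so the infinite sum is a finite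
  one over an index set depending only on \<open>L\<close> and \<open>n\<close>.\<close>

lemma dyadic_entropy_eq:
  "dyadic_entropy \<mu> n = (\<Sum>c\<in>square_indices L n. - mass n c * log 2 (mass n c))"
proof -
  have "dyadic_entropy \<mu> n = infsum (\<lambda>c. - mass n c * log 2 (mass n c)) (square_indices L n)"
    unfolding dyadic_entropy_def
    by (rule infsum_cong_neutral) (auto simp: mass_outside dest: mass_outside)
  then show ?thesis by simp
qed

text \<open>A termwise comparison: a square of positive mass meeting \<open>G\<close> contributes at
  least \<open>h\<close> times its mass, and all other terms are nonnegative.\<close>

lemma dyadic_entropy_lower:
  assumes G: "G \<in> events" and h: "h \<ge> 0"
    and small: "\<And>x c. x \<in> G \<Longrightarrow> x \<in> square n c \<Longrightarrow> mass n c > 0 \<Longrightarrow> h \<le> - log 2 (mass n c)"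
  shows "h * prob G \<le> dyadic_entropy \<mu> n"
proof -
  have "h * prob G = (\<Sum>c\<in>square_indices L n. h * prob (square n c \<inter> G))"
    using sum_measure_square_indices[OF G] by (simp add: sum_distrib_left[symmetric])
  also have "\<dots> \<le> (\<Sum>c\<in>square_indices L n. - mass n c * log 2 (mass n c))"
  proof (intro sum_mono)
    fix c
    have le: "prob (square n c \<inter> G) \<le> mass n c"
      by (intro finite_measure_mono) auto
    show "h * prob (square n c \<inter> G) \<le> - mass n c * log 2 (mass n c)"
    proof (cases "square n c \<inter> G = {} \<or> mass n c = 0")
      case True
      then have "prob (square n c \<inter> G) = 0" using le by (auto simp: measure_le_0_iff)
      moreover have "mass n c * log 2 (mass n c) \<le> 0"
        by (cases "mass n c = 0") (auto intro!: mult_nonneg_nonpos simp: log_le_zero_cancel_iff zero_less_measure_iff)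
      ultimately show ?thesis by simp
    next
      case False
      then obtain x where "x \<in> G" "x \<in> square n c" by auto
      then have "h \<le> - log 2 (mass n c)" using small False by (simp add: zero_less_measure_iff)
      then have "mass n c * h \<le> mass n c * (- log 2 (mass n c))"
        by (intro mult_left_mono) auto
      moreover have "h * prob (square n c \<inter> G) \<le> h * mass n c" using le h by (intro mult_left_mono)
      ultimately show ?thesis by (simp add: mult.commute)
    qed
  qed
  finally show ?thesis by (simp add: dyadic_entropy_eq)
qed

text \<open>After scaling by \<open>2 ^ n\<close>, coordinates at distance less than 2 have floors
  at most 2 apart, which gives a block of 5 by 5 squares.\<close>

lemma ball_subset_neighbours:
  assumes "x \<in> square n c"
  shows "ball x (2 * (1/2) ^ n) \<subseteq> (\<Union>d\<in>{-2..2}\<times>{-2..2}. square n (c + d))"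
proof
  fix y assume "y \<in> ball x (2 * (1/2) ^ n)"
  then have d: "cmod (x - y) < 2 * (1/2) ^ n" by (simp add: dist_norm)
  have *: "\<lfloor>v * 2 ^ n\<rfloor> - \<lfloor>u * 2 ^ n\<rfloor> \<in> {-2..2}" if "\<bar>u - v\<bar> < 2 * (1/2) ^ n" for u v :: real
  proof -
    have "\<bar>u - v\<bar> * 2 ^ n < 2 * (1/2) ^ n * 2 ^ n" using that by (intro mult_strict_right_mono) auto
    also have "\<dots> = 2" by (simp add: power_one_over)
    finally have "\<bar>u * 2 ^ n - v * 2 ^ n\<bar> < 2"
      by (metis abs_mult abs_numeral left_diff_distrib power_abs)
    then show ?thesis by (simp, linarith)
  qed
  define e where "e = (\<lfloor>Re y * 2 ^ n\<rfloor> - fst c, \<lfloor>Im y * 2 ^ n\<rfloor> - snd c)"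
  have "\<bar>Re x - Re y\<bar> < 2 * (1/2) ^ n" "\<bar>Im x - Im y\<bar> < 2 * (1/2) ^ n"
    using d abs_Re_le_cmod[of "x - y"] abs_Im_le_cmod[of "x - y"] by (auto simp del: power_one_over)
  from *[OF this(1)] *[OF this(2)] have "e \<in> {-2..2}\<times>{-2..2}"
    using assms by (auto simp: e_def mem_dyadic_square_iff)
  moreover have "y \<in> square n (c + e)" by (simp add: mem_dyadic_square_iff e_def)
  ultimately show "y \<in> (\<Union>d\<in>{-2..2}\<times>{-2..2}. square n (c + d))" by blast
qed

lemma L_pos: "L > 0"
proof (rule ccontr)
  assume "\<not> L > 0"
  then have "\<not> cmod z < L" for z by (smt (verit) norm_ge_zero of_int_le_0_iff)
  then show False using bounded by simp
qed

text \<open>Gibbs' inequality is applied to the mixture of the average of \<open>\<mu>\<close> over the 25 neighbouring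
  squares, which controls the squares meeting \<open>G\<close>, and of the uniform distribution, which controls
  the others.\<close>

lemma dyadic_entropy_upper:
  assumes G: "G \<in> events" and h: "h \<ge> 0"
    and large: "\<And>x c. x \<in> G \<Longrightarrow> x \<in> square n c \<Longrightarrow> mass n c > 0 \<Longrightarrow>
       2 powr (- h) \<le> prob (ball x (2 * (1/2) ^ n))"
  shows "dyadic_entropy \<mu> n \<le> log 2 50 + h + (1 - prob G) * log 2 (2 * (2 * L * 2 ^ n)\<^sup>2)"
proof -
  define S where "S = square_indices L n"
  define N where "N = (2 * L * 2 ^ n)\<^sup>2"
  define W where "W = ({-2..2}\<times>{-2..2} :: (int \<times> int) set)"
  \<comment> \<open>Each of the 25 translates has total mass at most 1, so the first term sums to at
    most \<open>25 / 50\<close>; the uniform term sums to the other half.\<close>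
  define v where "v c = (\<Sum>d\<in>W. mass n (c + d)) / 50 + 1 / (2 * N)" for c
  have N: "real (card S) = N" unfolding N_def S_def using card_square_indices[of L n] L_pos by simp
  have "1 \<le> 2 * L * 2 ^ n" using L_pos by (simp add: int_one_le_iff_zero_less)
  then have "1 \<le> N" unfolding N_def by (smt (verit) one_le_power)
  then have N1: "1 \<le> real_of_int N" by simp
  have vpos: "v c > 0" and vN: "1 / (2 * N) \<le> v c" for c
    unfolding v_def using N1 by (auto intro!: add_nonneg_pos sum_nonneg divide_nonneg_pos)
  have sm: "(\<Sum>c\<in>S. mass n c) = 1"
    using sum_measure_square_indices[of UNIV n] prob_space by (simp add: S_def sets_eq)
  have "(\<Sum>c\<in>S. \<Sum>d\<in>W. mass n (c + d)) = (\<Sum>d\<in>W. \<Sum>c\<in>S. mass n (c + d))"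
    by (rule sum.swap)
  also have "\<dots> = (\<Sum>d\<in>W. \<Sum>c\<in>(\<lambda>c. c + d) ` S. mass n c)"
    by (rule sum.cong[OF refl]) (simp add: sum.reindex inj_on_def)
  also have "\<dots> \<le> (\<Sum>d\<in>W. 1)"
    by (intro sum_mono sum_mass_le_1) (simp add: S_def)
  also have "\<dots> = 25" by (simp add: W_def card_cartesian_product)
  finally have "(\<Sum>c\<in>S. v c) \<le> 25 / 50 + card S * (1 / (2 * N))"
    by (simp add: v_def sum.distrib sum_divide_distrib[symmetric])
  then have sv: "(\<Sum>c\<in>S. v c) \<le> 1" using N N1 by simp
  have "dyadic_entropy \<mu> n \<le> (\<Sum>c\<in>S. - mass n c * log 2 (v c))"
    unfolding dyadic_entropy_eq S_def[symmetric]
    using vpos sv sm by (intro gibbs_inequality) (auto simp: S_def)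
  \<comment> \<open>In a square meeting \<open>G\<close> the ball bound gives \<open>v c\<close> at
    least \<open>2 powr (- h) / 50\<close>; in any other square the uniform term gives at least
    \<open>1 / (2 * N)\<close>. Only mass outside \<open>G\<close> is charged the large cost
    \<open>log 2 (2 * N)\<close>.\<close>
  also have "\<dots> \<le> (\<Sum>c\<in>S. mass n c * (log 2 50 + h) + (mass n c - prob (square n c \<inter> G)) * log 2 (2 * N))"
  proof (intro sum_mono)
    fix c
    have le: "prob (square n c \<inter> G) \<le> mass n c"
      by (intro finite_measure_mono) auto
    have l2N: "0 \<le> log 2 (2 * N)" using N1 by simp
    show "- mass n c * log 2 (v c) \<le>
      mass n c * (log 2 50 + h) + (mass n c - prob (square n c \<inter> G)) * log 2 (2 * N)"
    proof (cases "mass n c = 0")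
      case True
      then have "prob (square n c \<inter> G) = 0" using le by (simp add: measure_le_0_iff)
      then show ?thesis using True by simp
    next
      case m: False
      show ?thesis
      proof (cases "square n c \<inter> G = {}")
        case True
        have "- log 2 (v c) \<le> - log 2 (1 / (2 * N))" using vN[of c] N1 vpos by simp
        also have "\<dots> = log 2 (2 * N)" using N1 by (simp add: log_divide)
        finally have "mass n c * (- log 2 (v c)) \<le> mass n c * log 2 (2 * N)"
          by (intro mult_left_mono) auto
        moreover have "0 \<le> mass n c * (log 2 50 + h)" using h by (intro mult_nonneg_nonneg add_nonneg_nonneg) auto
        ultimately show ?thesis using True by simp
      next
        case False
        then obtain x where x: "x \<in> G" "x \<in> square n c" by auto
        have "2 powr (- h) \<le> prob (ball x (2 * (1/2) ^ n))"
          using large x m by (simp add: zero_less_measure_iff)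
        also have "\<dots> \<le> prob (\<Union>d\<in>W. square n (c + d))"
          using ball_subset_neighbours[OF x(2)] by (intro finite_measure_mono) (auto simp: W_def)
        also have "\<dots> \<le> (\<Sum>d\<in>W. mass n (c + d))"
          by (intro finite_measure_subadditive_finite) (auto simp: W_def)
        also have "\<dots> \<le> 50 * v c" using N1 by (simp add: v_def)
        finally have "2 powr (- h) / 50 \<le> v c" by simp
        then have "log 2 (2 powr (- h) / 50) \<le> log 2 (v c)" by (subst log_le_cancel_iff) (auto simp: vpos)
        then have "- log 2 (v c) \<le> log 2 50 + h" by (simp add: log_divide)
        then have "mass n c * (- log 2 (v c)) \<le> mass n c * (log 2 50 + h)"
          by (intro mult_left_mono) auto
        moreover have "0 \<le> (mass n c - prob (square n c \<inter> G)) * log 2 (2 * N)"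
          using le l2N by (intro mult_nonneg_nonneg) auto
        ultimately show ?thesis by simp
      qed
    qed
  qed
  also have "\<dots> = log 2 50 + h + (1 - prob G) * log 2 (2 * N)"
    using sm sum_measure_square_indices[OF G, of n]
    by (simp add: sum.distrib sum_distrib_right[symmetric] sum_subtractf S_def)
  finally show ?thesis unfolding N_def by simp
qed

section \<open>From local dimension to the entropy limit\<close>

text \<open>The ball is a section of the measurable set of pairs at distance less than
  \<open>r\<close>. This makes the sets of good points below events.\<close>

lemma prob_ball_measurable [measurable]: "(\<lambda>x. prob (ball x r)) \<in> borel_measurable \<mu>"
proof -
  define Q where "Q = {z \<in> space (\<mu> \<Otimes>\<^sub>M \<mu>). dist (fst z) (snd z) < r}"
  have "Q \<in> sets (\<mu> \<Otimes>\<^sub>M \<mu>)" unfolding Q_def by measurable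
  then have "(\<lambda>x. emeasure \<mu> (Pair x -` Q)) \<in> borel_measurable \<mu>" by (rule measurable_emeasure_Pair)
  moreover have "Pair x -` Q = ball x r" for x by (auto simp: Q_def space_pair_measure)
  ultimately show ?thesis unfolding measure_def by simp
qed

text \<open>Each coordinate varies by less than one side, and the modulus is at most the sum of both
  variations; hence the factor 2 in the radius.\<close>

lemma square_subset_ball:
  assumes "x \<in> square n c"
  shows "square n c \<subseteq> ball x (2 * (1/2) ^ n)"
proof
  fix y assume "y \<in> square n c"
  then have "\<bar>Re x - Re y\<bar> < 1 / 2 ^ n" "\<bar>Im x - Im y\<bar> < 1 / 2 ^ n"
    using assms by (auto simp: dyadic_square_def add_divide_distrib)
  then show "y \<in> ball x (2 * (1/2) ^ n)"
    using cmod_le[of "x - y"] by (simp add: dist_norm power_one_over)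
qed

text \<open>Local dimensions sampled at radii \<open>2 * (1/2) ^ n\<close> converge in probability.
  Off an event of vanishing probability they control the masses of balls, and the two entropy bounds
  apply with \<open>h\<close> close to \<open>n * \<alpha>\<close>.\<close>

lemma H_norm_tendsto:
  assumes dim: "exact_dim \<mu> \<alpha>"
  shows "(\<lambda>n. H_norm n \<mu>) \<longlonglongrightarrow> \<alpha>"
proof -
  define \<rho> where "\<rho> n x = ln (prob (ball x (2 * (1/2) ^ n))) / ln (2 * (1/2) ^ n)" for n :: nat and x
  have r: "filterlim (\<lambda>n. 2 * (1/2) ^ n :: real) (at_right 0) sequentially"
    by (rule tendsto_imp_filterlim_at_right) (auto intro!: tendsto_eq_intros LIMSEQ_power_zero)
  have AE: "AE x in \<mu>. (\<lambda>n. \<rho> n x) \<longlonglongrightarrow> \<alpha>"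
    using dim unfolding exact_dim_def
    by eventually_elim (unfold \<rho>_def, rule filterlim_compose[OF _ r])
  have ln_r: "ln (2 * (1/2) ^ n :: real) = - (real n - 1) * ln 2" for n
    by (simp add: ln_mult ln_realpow ln_div algebra_simps)
  \<comment> \<open>At \<open>n = 1\<close> the denominator is \<open>ln 1 = 0\<close> and the
    quotient is 0 by convention; the estimates on \<open>G\<close> therefore start at
    \<open>n = 2\<close>.\<close>
  have \<rho>_nonneg: "0 \<le> \<rho> n x" if "n \<ge> 1" for n x
  proof -
    have "ln (prob (ball x (2 * (1/2) ^ n))) \<le> 0"
      by (cases "prob (ball x (2 * (1/2) ^ n)) = 0") (auto simp: zero_less_measure_iff)
    then show ?thesis unfolding \<rho>_def ln_r using that by (auto intro!: divide_nonpos_nonpos mult_nonpos_nonneg)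
  qed
  \<comment> \<open>This secures the condition \<open>h \<ge> 0\<close> of the upper entropy
    bound.\<close>
  have \<alpha>: "\<alpha> \<ge> 0"
  proof (rule ccontr)
    assume neg: "\<not> \<alpha> \<ge> 0"
    have "\<not> (\<lambda>n. \<rho> n x) \<longlonglongrightarrow> \<alpha>" for x
    proof
      assume "(\<lambda>n. \<rho> n x) \<longlonglongrightarrow> \<alpha>"
      then have "0 \<le> \<alpha>" by (rule LIMSEQ_le_const) (use \<rho>_nonneg in blast)
      then show False using neg by simp
    qed
    then show False using AE by simp
  qed
  define G where "G n e = {x \<in> space \<mu>. \<bar>\<rho> n x - \<alpha>\<bar> < e}" for n e
  have G[measurable]: "G n e \<in> events" for n e
    unfolding G_def \<rho>_def by measurable
  have probG: "(\<lambda>n. prob (G n e)) \<longlonglongrightarrow> 1" if "e > 0" for e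
  proof (rule prob_tendsto_1)
    show "AE x in \<mu>. eventually (\<lambda>n. x \<in> G n e) sequentially"
      using AE
    proof eventually_elim
      case (elim x)
      from tendstoD[OF this that] show ?case by (simp add: G_def dist_real_def)
    qed
  qed (rule G)
  have ball: "0 < prob (ball x (2 * (1/2) ^ n))" "mass n c \<le> prob (ball x (2 * (1/2) ^ n))"
    "(real n - 1) * (\<alpha> - e) \<le> - log 2 (prob (ball x (2 * (1/2) ^ n)))"
    "- log 2 (prob (ball x (2 * (1/2) ^ n))) \<le> (real n - 1) * (\<alpha> + e)"
    if "n \<ge> 2" "x \<in> G n e" "x \<in> square n c" "mass n c > 0" for n x e c
  proof -
    define b where "b = prob (ball x (2 * (1/2) ^ n))"
    have "mass n c \<le> b"
      unfolding b_def using square_subset_ball[OF that(3)] by (intro finite_measure_mono) (auto simp: sets_eq)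
    moreover have "- log 2 b = (real n - 1) * \<rho> n x"
      unfolding \<rho>_def ln_r b_def using that(1) by (simp add: log_def divide_simps) (simp add: algebra_simps)?
    moreover have "\<alpha> - e \<le> \<rho> n x" "\<rho> n x \<le> \<alpha> + e" using that(2) by (auto simp: G_def)
    ultimately show "0 < prob (ball x (2 * (1/2) ^ n))" "mass n c \<le> prob (ball x (2 * (1/2) ^ n))"
      "(real n - 1) * (\<alpha> - e) \<le> - log 2 (prob (ball x (2 * (1/2) ^ n)))"
      "- log 2 (prob (ball x (2 * (1/2) ^ n))) \<le> (real n - 1) * (\<alpha> + e)"
      using that(1,4) unfolding b_def by (auto intro!: mult_left_mono)
  qed
  have lower: "eventually (\<lambda>n. H_norm n \<mu> > a) sequentially" if "a < \<alpha>" for a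
  proof -
    define e where "e = (\<alpha> - a) / 2"
    have e: "e > 0" "a < \<alpha> - e" using that by (auto simp: e_def field_simps)
    \<comment> \<open>Truncation at 0 keeps \<open>h\<close> nonnegative; where it takes effect, the
      required bound only says that a mass is at most 1.\<close>
    define g where "g = max 0 (\<alpha> - e)"
    have le: "(real n - 1) / n * g * prob (G n e) \<le> H_norm n \<mu>" if n: "n \<ge> 2" for n
    proof -
      have "(real n - 1) * g * prob (G n e) \<le> dyadic_entropy \<mu> n"
      proof (rule dyadic_entropy_lower[OF G])
        show "0 \<le> (real n - 1) * g" using n by (simp add: g_def)
        fix x c assume A: "x \<in> G n e" "x \<in> square n c" "mass n c > 0"
        have "log 2 (mass n c) \<le> log 2 (prob (ball x (2 * (1/2) ^ n)))"
          using ball(1,2)[OF n A] A(3) by (subst log_le_cancel_iff) auto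
        moreover have "log 2 (mass n c) \<le> 0" using A(3) by simp
        ultimately show "(real n - 1) * g \<le> - log 2 (mass n c)"
          using ball(3)[OF n A] by (auto simp: g_def max_def)
      qed
      then have "(real n - 1) * g * prob (G n e) / n \<le> H_norm n \<mu>"
        unfolding H_norm_def by (intro divide_right_mono) auto
      then show ?thesis by (simp add: mult.assoc)
    qed
    have "(\<lambda>n. (real n - 1) / n) \<longlonglongrightarrow> 1" by real_asymp
    from tendsto_mult[OF tendsto_mult[OF this tendsto_const[of g]] probG[OF e(1)]]
    have "(\<lambda>n. (real n - 1) / n * g * prob (G n e)) \<longlonglongrightarrow> g" by simp
    moreover have "a < g" using e by (simp add: g_def)
    ultimately have "eventually (\<lambda>n. a < (real n - 1) / n * g * prob (G n e)) sequentially"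
      by (rule order_tendstoD)
    then show ?thesis using eventually_ge_at_top[of 2]
      by eventually_elim (use le in fastforce)
  qed
  have upper: "eventually (\<lambda>n. H_norm n \<mu> < a) sequentially" if "a > \<alpha>" for a
  proof -
    define e where "e = (a - \<alpha>) / 2"
    have e: "e > 0" "\<alpha> + e < a" using that by (auto simp: e_def field_simps)
    \<comment> \<open>The last quotient tends to 2, so the contribution of the bad set vanishes
      together with \<open>1 - prob (G n e)\<close>.\<close>
    define U where "U n = log 2 50 / n + (real n - 1) / n * (\<alpha> + e) +
      (1 - prob (G n e)) * ((1 + 2 * (log 2 (2 * L) + n)) / n)" for n
    have le: "H_norm n \<mu> \<le> U n" if n: "n \<ge> 2" for n
    proof -
      have "dyadic_entropy \<mu> n \<le> log 2 50 + (real n - 1) * (\<alpha> + e) +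
         (1 - prob (G n e)) * log 2 (2 * (2 * L * 2 ^ n)\<^sup>2)"
      proof (rule dyadic_entropy_upper[OF G])
        show "0 \<le> (real n - 1) * (\<alpha> + e)" using n e \<alpha> by simp
        fix x c assume A: "x \<in> G n e" "x \<in> square n c" "mass n c > 0"
        show "2 powr - ((real n - 1) * (\<alpha> + e)) \<le> prob (ball x (2 * (1/2) ^ n))"
          using ball(1,4)[OF n A] by (subst le_log_iff[symmetric]) auto
      qed
      also have "log 2 (2 * (2 * L * 2 ^ n)\<^sup>2) = 1 + 2 * (log 2 (2 * L) + n)"
        using L_pos by (simp only: of_int_mult of_int_power of_int_numeral)
          (simp add: log_mult log_nat_power)
      finally have "H_norm n \<mu> \<le> (log 2 50 + (real n - 1) * (\<alpha> + e) +
         (1 - prob (G n e)) * (1 + 2 * (log 2 (2 * L) + n))) / n"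
        unfolding H_norm_def by (intro divide_right_mono) auto
      then show ?thesis unfolding U_def by (subst (asm) add_divide_distrib, subst (asm) add_divide_distrib) simp
    qed
    have "(\<lambda>n. log 2 50 / real n) \<longlonglongrightarrow> 0" "(\<lambda>n. (real n - 1) / n) \<longlonglongrightarrow> 1"
      "(\<lambda>n. (1 + 2 * (log 2 (2 * L) + real n)) / n) \<longlonglongrightarrow> 2" by real_asymp+
    then have "U \<longlonglongrightarrow> 0 + 1 * (\<alpha> + e) + (1 - 1) * 2"
      unfolding U_def using probG[OF e(1)] by (intro tendsto_intros)
    then have "eventually (\<lambda>n. U n < a) sequentially"
      using e by (intro order_tendstoD) auto
    then show ?thesis using eventually_ge_at_top[of 2]
      by eventually_elim (use le in fastforce)
  qed
  show ?thesis by (rule order_tendstoI) (use lower upper in auto)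
qed

end

subsection \<open>Planar models\<close>

locale planar_model = contraction_ratios lam for lam :: "'i::finite \<Rightarrow> complex" +
  fixes k :: "'i \<Rightarrow> nat" and t :: "'i \<Rightarrow> nat \<Rightarrow> complex" and p :: "'i \<Rightarrow> nat \<Rightarrow> real"
  assumes p_pos: "\<And>i j. j < k i \<Longrightarrow> 0 < p i j"
    and p_sum: "\<And>i. (\<Sum>j<k i. p i j) = 1"
begin

abbreviation "digit \<equiv> digit_pmf k p"
abbreviation "\<eta> \<equiv> eta lam k t p"

definition coding :: "(nat \<Rightarrow> 'i) \<Rightarrow> (nat \<Rightarrow> nat) \<Rightarrow> complex" where
  "coding \<omega> u = (\<Sum>n. (\<Prod>j<n. lam (\<omega> j)) * t (\<omega> n) (u n))"

text \<open>The weights are nonnegative with sum 1, so \<open>embed_pmf\<close> really has them as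
  its point masses.\<close>

lemma set_digit_pmf: "set_pmf (digit i) \<subseteq> {..<k i}"
proof -
  let ?f = "\<lambda>j. if j < k i then p i j else 0"
  have nn: "0 \<le> ?f j" for j using p_pos[of j i] by (simp add: less_imp_le)
  have "(\<integral>\<^sup>+ j. ennreal (?f j) \<partial>count_space UNIV) = (\<Sum>j<k i. ennreal (?f j))"
    by (subst nn_integral_count_space'[of "{..<k i}"]) (auto split: if_splits)
  also have "\<dots> = ennreal (\<Sum>j<k i. ?f j)" by (rule sum_ennreal) (rule nn)
  also have "\<dots> = 1" using p_sum[of i] by simp
  finally have "set_pmf (digit i) = {j. ?f j \<noteq> 0}"
    unfolding digit_pmf_def using nn by (intro set_embed_pmf) auto
  then show ?thesis by auto
qed

definition "tmax = Max (insert 0 (\<Union>i. (\<lambda>j. cmod (t i j)) ` {..<k i}))"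

lemma tmax: "j < k i \<Longrightarrow> cmod (t i j) \<le> tmax" "0 \<le> tmax"
  unfolding tmax_def by (auto intro!: Max_ge)

text \<open>An integer strictly above the geometric bound on the coding series. It serves as
  \<open>L\<close> for all \<omega> simultaneously.\<close>

definition "radius = \<lfloor>tmax / (1 - rmax)\<rfloor> + 1"

lemma coding_bounded:
  assumes "\<And>n. u n < k (\<omega> n)"
  shows "cmod (coding \<omega> u) < radius"
proof -
  have bnd: "cmod ((\<Prod>j<n. lam (\<omega> j)) * t (\<omega> n) (u n)) \<le> rmax ^ n * tmax" for n
    unfolding norm_mult prod_norm[symmetric]
    using prod_lam_le[of \<omega> "{..<n}"] tmax assms rmax
    by (intro mult_mono) (auto intro!: prod_nonneg)
  have sums: "(\<lambda>n. rmax ^ n * tmax) sums (1 / (1 - rmax) * tmax)"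
    using rmax by (intro sums_mult2 geometric_sums) auto
  then have "cmod (coding \<omega> u) \<le> (\<Sum>n. rmax ^ n * tmax)"
    unfolding coding_def using bnd by (intro norm_suminf_le) (auto simp: sums_iff)
  also have "\<dots> = tmax / (1 - rmax)" using sums by (simp add: sums_iff)
  also have "\<dots> < radius" unfolding radius_def by linarith
  finally show ?thesis .
qed

lemma coding_measurable [measurable]:
  "coding \<omega> \<in> borel_measurable (PiM UNIV (\<lambda>n. measure_pmf (digit (\<omega> n))))"
  unfolding coding_def by measurable

lemma eta_eq: "\<eta> \<omega> = distr (PiM UNIV (\<lambda>n. measure_pmf (digit (\<omega> n)))) borel (coding \<omega>)"
  unfolding eta_def coding_def ..

text \<open>Almost surely all of the countably many digits are admissible, and then
  \<open>coding_bounded\<close> applies.\<close>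

lemma eta_bounded: "bounded_plane_measure (\<eta> \<omega>) radius"
proof -
  let ?Q = "PiM UNIV (\<lambda>n. measure_pmf (digit (\<omega> n)))"
  interpret Q: prob_space ?Q by (intro prob_space_PiM measure_pmf.prob_space_axioms)
  interpret prob_space "\<eta> \<omega>" unfolding eta_eq by (rule Q.prob_space_distr) simp
  show ?thesis
  proof
    show "sets (\<eta> \<omega>) = sets borel" by (simp add: eta_eq)
    have "AE u in ?Q. u n < k (\<omega> n)" for n
      using set_digit_pmf[of "\<omega> n"]
      by (intro AE_PiM_component[where P="\<lambda>x. x < k (\<omega> n)"] measure_pmf.prob_space_axioms)
         (auto simp: AE_measure_pmf_iff)
    then have "AE u in ?Q. \<forall>n. u n < k (\<omega> n)" by (simp add: AE_all_countable)
    then have "AE u in ?Q. cmod (coding \<omega> u) < radius"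
      by eventually_elim (use coding_bounded in blast)
    then show "AE z in \<eta> \<omega>. cmod z < radius"
      unfolding eta_eq by (subst AE_distr_iff) auto
  qed
qed

text \<open>Drawing a digit for every pair of a time and a symbol realises all the measures \<open>\<eta> \<omega>\<close> on one
  probability space that does not depend on \<open>\<omega>\<close>, which reduces measurability in \<open>\<omega>\<close> to Fubini.\<close>

definition digit_space :: "(nat \<times> 'i \<Rightarrow> nat) measure" where
  "digit_space = PiM UNIV (\<lambda>c. measure_pmf (digit (snd c)))"

text \<open>The map \<open>n \<mapsto> (n, \<omega> n)\<close> is injective, so the selected
  coordinates are again independent and have the laws \<open>digit (\<omega> n)\<close>.\<close>

lemma eta_eq_digit_space:
  "\<eta> \<omega> = distr digit_space borel (\<lambda>v. coding \<omega> (\<lambda>n. v (n, \<omega> n)))"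
proof -
  let ?Q = "PiM UNIV (\<lambda>n. measure_pmf (digit (\<omega> n)))"
  have law: "distr digit_space ?Q (\<lambda>v n. v (n, \<omega> n)) = ?Q"
    using distr_PiM_reindex[of UNIV "\<lambda>c. measure_pmf (digit (snd c))" "\<lambda>n. (n, \<omega> n)" UNIV]
    by (simp add: digit_space_def inj_on_def measure_pmf.prob_space_axioms restrict_UNIV)
  have meas: "(\<lambda>v n. v (n, \<omega> n)) \<in> measurable digit_space ?Q"
    unfolding digit_space_def by (intro measurable_PiM_single') auto
  have "distr (distr digit_space ?Q (\<lambda>v n. v (n, \<omega> n))) borel (coding \<omega>) =
      distr digit_space borel (\<lambda>v. coding \<omega> (\<lambda>n. v (n, \<omega> n)))"
    by (subst distr_distr[OF coding_measurable meas]) (simp add: comp_def)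
  then show ?thesis unfolding law eta_eq .
qed

lemma eta_measurable:
  assumes [measurable]: "B \<in> sets borel"
  shows "(\<lambda>\<omega>. measure (\<eta> \<omega>) B) \<in> borel_measurable Omega_space"
proof -
  interpret D: prob_space digit_space
    unfolding digit_space_def by (intro prob_space_PiM measure_pmf.prob_space_axioms)
  have coord[measurable]: "(\<lambda>z. fst z n) \<in> measurable (Omega_space \<Otimes>\<^sub>M digit_space) (count_space UNIV)" for n
    unfolding Omega_space_def by measurable
  have dig[measurable]: "(\<lambda>z. snd z c) \<in> measurable (Omega_space \<Otimes>\<^sub>M digit_space) (count_space UNIV)" for c
    unfolding digit_space_def by (rule measurable_compose[OF measurable_snd]) simp
  have joint: "(\<lambda>z. coding (fst z) (\<lambda>n. snd z (n, fst z n))) \<in> borel_measurable (Omega_space \<Otimes>\<^sub>M digit_space)"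
  proof -
    \<comment> \<open>The selected coordinate is itself random, but \<open>fst z n\<close> has
      countably many values, so each value can be fixed in turn.\<close>
    have "(\<lambda>z. t (fst z n) (snd z (n, fst z n))) \<in> borel_measurable (Omega_space \<Otimes>\<^sub>M digit_space)" for n
      by (rule measurable_compose_countable[OF _ coord[of n]], rule measurable_compose[OF dig]) simp
    moreover have "(\<lambda>z. lam (fst z j)) \<in> borel_measurable (Omega_space \<Otimes>\<^sub>M digit_space)" for j
      by (rule measurable_compose[OF coord[of j]]) simp
    ultimately show ?thesis
      unfolding coding_def by (intro borel_measurable_suminf borel_measurable_times borel_measurable_prod)
  qed
  define Q where "Q = {z \<in> space (Omega_space \<Otimes>\<^sub>M digit_space). coding (fst z) (\<lambda>n. snd z (n, fst z n)) \<in> B}"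
  have "Q \<in> sets (Omega_space \<Otimes>\<^sub>M digit_space)" unfolding Q_def using joint by measurable
  then have *: "(\<lambda>\<omega>. emeasure digit_space (Pair \<omega> -` Q)) \<in> borel_measurable Omega_space"
    by (rule D.measurable_emeasure_Pair)
  have "measure (\<eta> \<omega>) B = enn2real (emeasure digit_space (Pair \<omega> -` Q))"
    if "\<omega> \<in> space Omega_space" for \<omega>
  proof -
    have m: "(\<lambda>v. coding \<omega> (\<lambda>n. v (n, \<omega> n))) \<in> borel_measurable digit_space"
      using measurable_compose[OF measurable_Pair1'[OF that] joint] by simp
    have "emeasure (\<eta> \<omega>) B = emeasure digit_space ((\<lambda>v. coding \<omega> (\<lambda>n. v (n, \<omega> n))) -` B \<inter> space digit_space)"
      unfolding eta_eq_digit_space by (rule emeasure_distr[OF m assms])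
    also have "(\<lambda>v. coding \<omega> (\<lambda>n. v (n, \<omega> n))) -` B \<inter> space digit_space = Pair \<omega> -` Q"
      using that by (auto simp: Q_def space_pair_measure)
    finally show ?thesis by (simp add: measure_def)
  qed
  then show ?thesis by (subst measurable_cong[where g="\<lambda>\<omega>. enn2real (emeasure digit_space (Pair \<omega> -` Q))"]) (use * in auto)
qed

text \<open>Since \<open>radius\<close> does not depend on \<omega>, the entropy is a sum over one
  fixed finite set of squares.\<close>

lemma H_norm_eta_measurable: "(\<lambda>\<omega>. H_norm n (\<eta> \<omega>)) \<in> borel_measurable Omega_space"
  unfolding H_norm_def bounded_plane_measure.dyadic_entropy_eq[OF eta_bounded]
  by (intro borel_measurable_divide borel_measurable_sum borel_measurable_times
      borel_measurable_uminus borel_measurable_log eta_measurable dyadic_square_borel borel_measurable_const)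

lemma nprime_measurable: "nprime lam R n \<in> measurable Omega_space (count_space UNIV)"
proof -
  have [measurable]: "(\<lambda>\<omega>. \<omega> n) \<in> measurable Omega_space (count_space UNIV)" for n
    unfolding Omega_space_def by measurable
  have [measurable]: "(\<lambda>i. cmod (lam i)) \<in> borel_measurable (count_space UNIV)" by simp
  show ?thesis unfolding nprime_def by measurable
qed

end

section \<open>Convergence in probability along the stopped shift\<close>

theorem lemma3p11:
  fixes lam :: "'i::finite \<Rightarrow> complex"
    and k :: "'i \<Rightarrow> nat"
    and t :: "'i \<Rightarrow> nat \<Rightarrow> complex"
    and p :: "'i \<Rightarrow> nat \<Rightarrow> real"
    and P :: "(nat \<Rightarrow> 'i) measure"
    and R \<alpha> \<delta> :: real
    and q :: nat
  assumes lam: "\<And>i. 0 < cmod (lam i) \<and> cmod (lam i) < 1"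
    and p_pos: "\<And>i j. j < k i \<Longrightarrow> 0 < p i j"
    and p_sum: "\<And>i. (\<Sum>j<k i. p i j) = 1"
    and R_pos: "0 < R"
    and R_inv: "\<And>i j. j < k i \<Longrightarrow> closure ((\<lambda>z. lam i * z + t i j) ` ball 0 R) \<subseteq> ball 0 R"
    and R_big: "2 * R * (MIN i. cmod (lam i)) > 1/2"
    and P: "ergodic_selection P"
    and dim: "AE \<omega> in P. exact_dim (eta lam k t p \<omega>) \<alpha>"
    and q: "q \<ge> 1"
    and \<delta>: "\<delta> > 0"
  shows "(\<lambda>n. measure P {\<omega> \<in> space P.
            \<bar>H_norm (q * n) (eta lam k t p ((shift ^^ nprime lam R n \<omega>) \<omega>)) - \<alpha>\<bar> < \<delta>})
         \<longlonglongrightarrow> 1"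
proof -
  interpret planar_model lam k t p by unfold_locales (use lam p_pos p_sum in auto)
  from P have setsP [measurable_cong]: "sets P = sets Omega_space"
    and shift [measurable]: "shift \<in> measurable P P" and inv: "distr P P shift = P"
    and pr: "prob_space P"
    by (auto simp: ergodic_selection_def)
  interpret P: prob_space P by (rule pr)
  note [measurable] = H_norm_eta_measurable
  have nprime_P: "nprime lam R n \<in> measurable P (count_space UNIV)" for n
    using nprime_measurable measurable_cong_sets[OF setsP refl] by blast
  have spP: "space P = UNIV"
    using sets_eq_imp_space_eq[OF setsP] by (simp add: Omega_space_def space_PiM)
  define A where "A n = {\<omega> \<in> space P. \<bar>H_norm (q * n) (\<eta> \<omega>) - \<alpha>\<bar> < \<delta>}" for n
  have A [measurable]: "A n \<in> sets P" for n unfolding A_def by measurable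
  have "AE \<omega> in P. eventually (\<lambda>n. \<omega> \<in> A n) sequentially"
    using dim
  proof eventually_elim
    case (elim \<omega>)
    have "(\<lambda>n. H_norm n (\<eta> \<omega>)) \<longlonglongrightarrow> \<alpha>"
      using bounded_plane_measure.H_norm_tendsto[OF eta_bounded elim] .
    moreover have "filterlim (\<lambda>n. q * n) at_top sequentially"
      using q by (intro mult_nat_left_at_top) auto
    ultimately have "(\<lambda>n. H_norm (q * n) (\<eta> \<omega>)) \<longlonglongrightarrow> \<alpha>"
      by (rule filterlim_compose)
    from tendstoD[OF this \<delta>] show ?case by (simp add: A_def spP dist_real_def)
  qed
  then have A1: "(\<lambda>n. P.prob (A n)) \<longlonglongrightarrow> 1" by (intro P.prob_tendsto_1 A)
  \<comment> \<open>\<open>K\<close> depends on the ratios alone, so the loss factor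
    \<open>Suc K\<close> stays fixed as \<open>n\<close> grows.\<close>
  have "(\<lambda>K. rmax ^ K) \<longlonglongrightarrow> 0" using rmax by (intro LIMSEQ_power_zero) auto
  from order_tendstoD(2)[OF this rmin(1)] obtain K where K: "rmax ^ K \<le> rmin"
    by (auto simp: eventually_sequentially intro: less_imp_le)
  define B where "B n = {\<omega> \<in> space P. (shift ^^ nprime lam R n \<omega>) \<omega> \<in> A n}" for n
  \<comment> \<open>The iterate bound is applied to the complement of \<open>A n\<close>, whose
    small probability survives a constant factor. The bound \<open>m\<close> on the stopping time
    may depend on \<open>n\<close>, as it does not enter the estimate.\<close>
  have B_le: "1 - real (Suc K) * (1 - P.prob (A n)) \<le> P.prob (B n)" for n
  proof -
    obtain m where m: "\<And>w. nprime lam R n w \<le> m" using nprime_bounded by blast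
    have "P.prob {\<omega> \<in> space P. (shift ^^ nprime lam R n \<omega>) \<omega> \<in> space P - A n} \<le>
        real (Suc K) * P.prob (space P - A n)"
      by (rule P.measure_random_iterate_le[OF shift inv nprime_P m _ card_nprime_le[OF R_pos K]]) auto
    moreover have "{\<omega> \<in> space P. (shift ^^ nprime lam R n \<omega>) \<omega> \<in> space P - A n} = space P - B n"
      by (auto simp: B_def spP)
    moreover have "B n \<in> sets P"
    proof -
      have "shift ^^ j \<in> measurable P P" for j by (induction j) auto
      then have "(\<lambda>\<omega>. (shift ^^ nprime lam R n \<omega>) \<omega>) \<in> measurable P P"
        by (rule measurable_compose_countable[OF _ nprime_P])
      from measurable_sets[OF this A[of n]] show ?thesis by (simp add: B_def vimage_def Int_def conj_commute)
    qed
    ultimately show ?thesis by (simp add: P.prob_compl)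
  qed
  have "(\<lambda>n. P.prob (B n)) \<longlonglongrightarrow> 1"
  proof (rule tendsto_sandwich[OF always_eventually always_eventually _ tendsto_const])
    have "(\<lambda>n. 1 - real (Suc K) * (1 - P.prob (A n))) \<longlonglongrightarrow> 1 - real (Suc K) * (1 - 1)"
      by (intro tendsto_intros A1)
    then show "(\<lambda>n. 1 - real (Suc K) * (1 - P.prob (A n))) \<longlonglongrightarrow> 1" by simp
  qed (use B_le in auto)
  then show ?thesis by (simp add: B_def A_def spP)
qed

end
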